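(* Let $\mathcal{B}$ be a unital $C^*$-algebra and let $\mathcal{A}\subset\mathcal{B}$ be a Banach $*$-algebra with the same unit such that, for some $C>0$ and $0<\theta<1$, $$\|a^2\|_{\mathcal{A}}\le C\|a\|_{\mathcal{A}}^{1+\theta}\|a\|_{\mathcal{B}}^{1-\theta},\quad a\in\mathcal{A}.$$ Then $\mathcal{A}$ is inverse-closed in $\mathcal{B}$, and whenever $a\in\mathcal{A}$ is invertible, we have $$\|a^{-1}\|_{\mathcal{A}}\le\frac{\|a\|_{\mathcal{A}}}{\|a\|_{\mathcal{B}}^2}\prod_{k=0}^{\infty}\left(1+\left(2\frac{\|a\|_{\mathcal{A}}^2}{\|a\|_{\mathcal{B}}^2}\right)^{(1+\theta)^k}C^{\frac{(1+\theta)^k-1}{\theta}}\left(1-\frac{1}{\|a\|_{\mathcal{B}}^2\|a^{-1}\|_{\mathcal{B}}^2}\right)^{2^k-(1+\theta)^k}\right).$$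
   Context: $\mathcal{A}\subset\mathcal{B}$ is a $*$-subalgebra, with the involution of $\mathcal{A}$ being the restriction of that of $\mathcal{B}$, complete in its own submultiplicative norm $\|\cdot\|_{\mathcal{A}}$ with $\|a^*\|_{\mathcal{A}}=\|a\|_{\mathcal{A}}$ for $a\in\mathcal{A}$, and the common unit $e$ satisfies $\|e\|_{\mathcal{A}}=1$. $\mathcal{A}$ is inverse-closed in $\mathcal{B}$ if every $a\in\mathcal{A}$ that is invertible in $\mathcal{B}$ satisfies $a^{-1}\in\mathcal{A}$. In the $k=0$ factor, where the exponent $2^k-(1+\theta)^k$ is $0$, the convention $0^0=1$ is used. *)

theory Defs
  imports "HOL-Analysis.Analysis"
begin

text \<open>
  Unital \<open>C\<^sup>*\<close>-algebras over the complex numbers. The library only has real normed algebras, so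
  complex scalar multiplication (compatible with the real one) and the involution are added here.
  \<^class>\<open>real_normed_algebra_1\<close> contributes submultiplicativity, \<open>0 \<noteq> 1\<close> and \<open>norm 1 = 1\<close>;
  \<^class>\<open>banach\<close> contributes completeness.
\<close>

class unital_cstar_algebra = real_normed_algebra_1 + banach +
  fixes scaleC :: "complex \<Rightarrow> 'a \<Rightarrow> 'a"  (infixr \<open>*\<^sub>C\<close> 75)
    and adj :: "'a \<Rightarrow> 'a"
  assumes scaleC_of_real: "complex_of_real r *\<^sub>C x = r *\<^sub>R x"
    and scaleC_add_right: "c *\<^sub>C (x + y) = c *\<^sub>C x + c *\<^sub>C y"
    and scaleC_add_left: "(c + d) *\<^sub>C x = c *\<^sub>C x + d *\<^sub>C x"
    and scaleC_scaleC: "c *\<^sub>C d *\<^sub>C x = (c * d) *\<^sub>C x"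
    and scaleC_mult_left: "(c *\<^sub>C x) * y = c *\<^sub>C (x * y)"
    and scaleC_mult_right: "x * (c *\<^sub>C y) = c *\<^sub>C (x * y)"
    and norm_scaleC: "norm (c *\<^sub>C x) = cmod c * norm x"
    and adj_adj: "adj (adj x) = x"
    and adj_add: "adj (x + y) = adj x + adj y"
    and adj_scaleC: "adj (c *\<^sub>C x) = cnj c *\<^sub>C adj x"
    and adj_mult: "adj (x * y) = adj y * adj x"
    and cstar_identity: "norm (adj x * x) = (norm x)\<^sup>2"

text \<open>
  A unital \<open>*\<close>-subalgebra \<open>A\<close> of a \<open>C\<^sup>*\<close>-algebra which is a Banach \<open>*\<close>-algebra for a norm \<open>normA\<close>
  of its own; \<open>normA\<close> is only constrained on \<open>A\<close>, and no comparison with \<^const>\<open>norm\<close> is assumed.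
\<close>

locale banach_star_subalgebra =
  fixes A :: "'b::unital_cstar_algebra set"
    and normA :: "'b \<Rightarrow> real"
  assumes one_mem: "1 \<in> A"
    and add_mem: "x \<in> A \<Longrightarrow> y \<in> A \<Longrightarrow> x + y \<in> A"
    and scaleC_mem: "x \<in> A \<Longrightarrow> c *\<^sub>C x \<in> A"
    and mult_mem: "x \<in> A \<Longrightarrow> y \<in> A \<Longrightarrow> x * y \<in> A"
    and adj_mem: "x \<in> A \<Longrightarrow> adj x \<in> A"
    and normA_nonneg: "x \<in> A \<Longrightarrow> 0 \<le> normA x"
    and normA_eq_0_iff: "x \<in> A \<Longrightarrow> normA x = 0 \<longleftrightarrow> x = 0"
    and normA_triangle: "x \<in> A \<Longrightarrow> y \<in> A \<Longrightarrow> normA (x + y) \<le> normA x + normA y"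
    and normA_scaleC: "x \<in> A \<Longrightarrow> normA (c *\<^sub>C x) = cmod c * normA x"
    and normA_mult: "x \<in> A \<Longrightarrow> y \<in> A \<Longrightarrow> normA (x * y) \<le> normA x * normA y"
    and normA_adj: "x \<in> A \<Longrightarrow> normA (adj x) = normA x"
    and normA_one: "normA 1 = 1"
    and normA_complete:
      "\<lbrakk>\<And>n. f n \<in> A; \<forall>\<epsilon>>0. \<exists>N. \<forall>m\<ge>N. \<forall>n\<ge>N. normA (f m - f n) < \<epsilon>\<rbrakk>
        \<Longrightarrow> \<exists>l\<in>A. (\<lambda>n::nat. normA (f n - l)) \<longlonglongrightarrow> 0"

definition is_inverse :: "'b::monoid_mult \<Rightarrow> 'b \<Rightarrow> bool" where
  "is_inverse a b \<longleftrightarrow> a * b = 1 \<and> b * a = 1"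

definition inverse_closed :: "'b::monoid_mult set \<Rightarrow> bool" where
  "inverse_closed A \<longleftrightarrow> (\<forall>a\<in>A. \<forall>b. is_inverse a b \<longrightarrow> b \<in> A)"

text \<open>
  Real power of a nonnegative base with the convention \<open>0\<^sup>0 = 1\<close>; \<^const>\<open>powr\<close> has \<open>0 powr 0 = 0\<close>.
\<close>

definition powr0 :: "real \<Rightarrow> real \<Rightarrow> real" where
  "powr0 x y = (if y = 0 then 1 else x powr y)"

text \<open>
  The \<open>k\<close>-th factor of the product; in the application \<open>\<alpha>\<close>, \<open>\<beta>\<close> are the two norms of \<open>a\<close>
  (in \<open>A\<close> and in the \<open>C\<^sup>*\<close>-algebra) and \<open>\<gamma>\<close> is the \<open>C\<^sup>*\<close>-norm of the inverse.
\<close>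

definition inv_bound_factor :: "real \<Rightarrow> real \<Rightarrow> real \<Rightarrow> real \<Rightarrow> real \<Rightarrow> nat \<Rightarrow> real" where
  "inv_bound_factor C \<theta> \<alpha> \<beta> \<gamma> k =
     1 + (2 * (\<alpha>\<^sup>2 / \<beta>\<^sup>2)) powr ((1 + \<theta>) ^ k)
         * C powr (((1 + \<theta>) ^ k - 1) / \<theta>)
         * powr0 (1 - 1 / (\<beta>\<^sup>2 * \<gamma>\<^sup>2)) (2 ^ k - (1 + \<theta>) ^ k)"

end

theory Submission
  imports Defs
begin

text \<open>
  Let \<open>s = 1 - a\<^sup>* a / \<parallel>a\<parallel>\<^sup>2\<close>. Positivity of \<open>a\<^sup>* a\<close> gives
  \<open>\<parallel>s\<parallel> \<le> 1 - 1 / (\<parallel>a\<parallel>\<^sup>2 \<parallel>a\<^sup>-\<^sup>1\<parallel>\<^sup>2)\<close>, and \<open>\<parallel>a\<parallel> \<le> \<parallel>a\<parallel>\<^sub>A\<close> gives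
  \<open>\<parallel>s\<parallel>\<^sub>A \<le> 2 \<parallel>a\<parallel>\<^sub>A\<^sup>2 / \<parallel>a\<parallel>\<^sup>2\<close>. Iterating the hypothesis bounds \<open>\<parallel>s\<^bsup>2^k\<^esup>\<parallel>\<^sub>A\<close> by a summable
  sequence, so \<open>(1 - s)\<^sup>-\<^sup>1 = \<Prod>k. (1 + s\<^bsup>2^k\<^esup>)\<close> converges in \<open>A\<close>, and
  \<open>a\<^sup>-\<^sup>1 = (1 - s)\<^sup>-\<^sup>1 a\<^sup>* / \<parallel>a\<parallel>\<^sup>2\<close>.

  The \<open>C\<^sup>*\<close>-algebra facts are obtained without spectral theory: \<open>p\<close> counts as positive if
  \<open>\<parallel>t - p\<parallel> \<le> t\<close> for some \<open>t\<close>, and square roots of \<open>p + \<epsilon>\<close> come from a contraction.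
\<close>

section \<open>Self-adjoint and positive elements\<close>

lemma adj_scaleR: "adj (r *\<^sub>R x) = r *\<^sub>R adj (x :: 'b::unital_cstar_algebra)"
  using adj_scaleC[of "complex_of_real r" x] by (simp add: scaleC_of_real)

lemma adj_zero [simp]: "adj (0 :: 'b::unital_cstar_algebra) = 0"
  using adj_scaleR[of 0 "0::'b"] by simp

lemma adj_minus: "adj (- x) = - adj (x :: 'b::unital_cstar_algebra)"
  using adj_scaleR[of "-1" x] by simp

lemma adj_diff: "adj (x - y) = adj x - adj (y :: 'b::unital_cstar_algebra)"
  using adj_add[of x "- y"] by (simp add: adj_minus)

lemma adj_one [simp]: "adj (1 :: 'b::unital_cstar_algebra) = 1"
  by (metis adj_adj adj_mult mult.right_neutral)

text \<open>The \<open>cstar_identity\<close> and submultiplicativity give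
  \<open>norm y * norm y \<le> norm (adj y) * norm y\<close>; cancel \<open>norm y\<close> and use
  the result for \<open>x\<close> and for \<open>adj x\<close>.\<close>

lemma norm_adj: "norm (adj x) = norm (x :: 'b::unital_cstar_algebra)"
proof -
  have le: "norm y \<le> norm (adj y)" for y :: 'b
  proof (cases "y = 0")
    case False
    have "norm y * norm y \<le> norm (adj y) * norm y"
      using norm_mult_ineq[of "adj y" y] by (simp add: cstar_identity power2_eq_square)
    then show ?thesis using False by simp
  qed simp
  show ?thesis using le[of x] le[of "adj x"] by (simp add: adj_adj)
qed

lemma bounded_linear_adj: "bounded_linear (adj :: 'b::unital_cstar_algebra \<Rightarrow> 'b)"
  by (rule bounded_linear_intro[where K = 1]) (auto simp: adj_add adj_scaleR norm_adj)

definition selfadjoint :: "'b::unital_cstar_algebra \<Rightarrow> bool" where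
  "selfadjoint x \<longleftrightarrow> adj x = x"

lemma selfadjoint_simps [simp]:
  fixes x y :: "'b::unital_cstar_algebra"
  shows "selfadjoint (1 :: 'b)" "selfadjoint (0 :: 'b)"
    "selfadjoint x \<Longrightarrow> selfadjoint y \<Longrightarrow> selfadjoint (x + y)"
    "selfadjoint x \<Longrightarrow> selfadjoint y \<Longrightarrow> selfadjoint (x - y)"
    "selfadjoint x \<Longrightarrow> selfadjoint (- x)"
    "selfadjoint x \<Longrightarrow> selfadjoint (r *\<^sub>R x)"
    "selfadjoint x \<Longrightarrow> selfadjoint (x * x)"
    "selfadjoint (adj x * x)" "selfadjoint (x * adj x)"
  by (simp_all add: selfadjoint_def adj_add adj_diff adj_minus adj_scaleR adj_mult adj_adj)

lemma selfadjoint_mult: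
  "selfadjoint x \<Longrightarrow> selfadjoint y \<Longrightarrow> x * y = y * x \<Longrightarrow> selfadjoint (x * y)"
  by (simp add: selfadjoint_def adj_mult)

lemma norm_square_selfadjoint: "selfadjoint x \<Longrightarrow> norm (x * x) = (norm x)\<^sup>2"
  using cstar_identity[of x] by (simp add: selfadjoint_def)

section \<open>Inverses, bicommutants and square roots\<close>

lemma is_inverse_unique:
  "is_inverse a b \<Longrightarrow> is_inverse a c \<Longrightarrow> b = c"
  unfolding is_inverse_def by (metis mult.assoc mult.left_neutral mult.right_neutral)

lemma is_inverse_left_unique:
  "is_inverse a b \<Longrightarrow> c * a = 1 \<Longrightarrow> b = c"
  unfolding is_inverse_def by (metis mult.assoc mult.left_neutral mult.right_neutral)

text \<open>Applying \<open>adj\<close> to both inverse equations shows that \<open>adj b\<close> is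
  an inverse of \<open>a\<close> too, and inverses are unique.\<close>

lemma selfadjoint_inverse:
  assumes "is_inverse a b" "selfadjoint a"
  shows "selfadjoint b"
proof -
  have "adj a = a" "a * b = 1" "b * a = 1"
    using assms by (auto simp: is_inverse_def selfadjoint_def)
  then have "a * adj b = 1" "adj b * a = 1"
    using adj_mult[of b a] adj_mult[of a b] by simp_all
  then have "is_inverse a (adj b)" by (simp add: is_inverse_def)
  then show ?thesis unfolding selfadjoint_def by (rule is_inverse_unique[OF assms(1), symmetric])
qed

text \<open>Stands in for functional calculus: a square root in the bicommutant of \<open>x\<close>
  commutes with whatever commutes with \<open>x\<close>. The set is closed, so a fixed point can be
  sought inside it.\<close>

definition bicommutant :: "'b::monoid_mult \<Rightarrow> 'b set" where
  "bicommutant x = {y. \<forall>z. z * x = x * z \<longrightarrow> z * y = y * z}"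

lemma bicommutantD: "y \<in> bicommutant x \<Longrightarrow> z * x = x * z \<Longrightarrow> z * y = y * z"
  by (simp add: bicommutant_def)

text \<open>The square root is \<open>1 - y\<close> for the fixed point \<open>y\<close> of the contraction \<open>y \<mapsto> (x + y\<^sup>2) / 2\<close>.\<close>

lemma sqrt_one_minus:
  fixes x :: "'b::unital_cstar_algebra"
  assumes sa: "selfadjoint x" and lt: "norm x < 1"
  obtains y where "selfadjoint y" "norm y < 1" "(1 - y) * (1 - y) = 1 - x" "y \<in> bicommutant x"
proof -
  \<comment> \<open>The smaller root of \<open>t * t - 2 * t + norm x = 0\<close>. With this radius
    \<open>f\<close> maps the ball into itself, and its Lipschitz constant there is again
    \<rho>.\<close>
  define \<rho> where "\<rho> = 1 - sqrt (1 - norm x)"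
  have \<rho>: "0 \<le> \<rho>" "\<rho> < 1" using lt by (auto simp: \<rho>_def)
  have \<rho>2: "norm x + \<rho> * \<rho> = 2 * \<rho>"
    using lt by (simp add: \<rho>_def algebra_simps)
  define S where "S = {y. adj y = y} \<inter> cball 0 \<rho> \<inter> bicommutant x"
  define f where "f y = (1/2) *\<^sub>R (x + y * y)" for y
  have "closed {y :: 'b. adj y = y}"
    by (intro closed_Collect_eq continuous_intros linear_continuous_on bounded_linear_adj)
  moreover have "closed (bicommutant x)"
    unfolding bicommutant_def
    by (intro closed_Collect_all closed_Collect_imp closed_Collect_eq continuous_intros) simp
  ultimately have "complete S"
    unfolding S_def complete_eq_closed by (intro closed_Int closed_cball)
  moreover have "S \<noteq> {}"
  proof -
    have "0 \<in> S" using \<rho> by (simp add: S_def bicommutant_def)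
    then show ?thesis by blast
  qed
  moreover have "f ` S \<subseteq> S"
  proof (rule image_subsetI)
    fix y assume y: "y \<in> S"
    have ny: "norm y \<le> \<rho>" using y by (simp add: S_def)
    have "adj (f y) = f y"
      using y sa by (simp add: S_def f_def adj_scaleR adj_add adj_mult selfadjoint_def)
    moreover have "norm (f y) \<le> \<rho>"
    proof -
      have "norm (y * y) \<le> \<rho> * \<rho>"
        by (rule order_trans[OF norm_mult_ineq]) (use ny \<rho> in \<open>auto intro: mult_mono\<close>)
      then have "norm (x + y * y) \<le> 2 * \<rho>"
        using norm_triangle_ineq[of x "y * y"] \<rho>2 by linarith
      then show ?thesis by (simp add: f_def)
    qed
    moreover have "f y \<in> bicommutant x"
    proof -
      have "z * f y = f y * z" if "z * x = x * z" for z
      proof -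
        have "z * y = y * z" using y that by (auto simp: S_def bicommutant_def)
        then have "z * (y * y) = y * y * z" by (metis mult.assoc)
        then show ?thesis using that by (simp add: f_def algebra_simps)
      qed
      then show ?thesis by (simp add: bicommutant_def)
    qed
    ultimately show "f y \<in> S" by (simp add: S_def)
  qed
  moreover have "\<forall>y\<in>S. \<forall>z\<in>S. dist (f y) (f z) \<le> \<rho> * dist y z"
  proof (intro ballI)
    fix y z assume "y \<in> S" "z \<in> S"
    then have n: "norm y \<le> \<rho>" "norm z \<le> \<rho>" by (auto simp: S_def)
    have "norm (y * (y - z)) \<le> \<rho> * norm (y - z)"
      by (rule order_trans[OF norm_mult_ineq]) (use n in \<open>simp add: mult_right_mono\<close>)
    moreover have "norm ((y - z) * z) \<le> \<rho> * norm (y - z)"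
      by (rule order_trans[OF norm_mult_ineq], subst mult.commute)
        (use n in \<open>simp add: mult_right_mono\<close>)
    ultimately have "norm (y * (y - z) + (y - z) * z) \<le> 2 * (\<rho> * norm (y - z))"
      using norm_triangle_ineq[of "y * (y - z)" "(y - z) * z"] by linarith
    moreover have "f y - f z = (1/2) *\<^sub>R (y * (y - z) + (y - z) * z)"
      by (simp add: f_def algebra_simps)
    ultimately show "dist (f y) (f z) \<le> \<rho> * dist y z" by (simp add: dist_norm)
  qed
  ultimately obtain y where y: "y \<in> S" "f y = y"
    using Banach_fix[of S \<rho> f] \<rho> by blast
  show ?thesis
  proof
    show "selfadjoint y" "norm y < 1" "y \<in> bicommutant x"
      using y \<rho> by (auto simp: S_def selfadjoint_def)
    have "x + y * y = 2 *\<^sub>R y" using arg_cong[OF y(2), of "\<lambda>u. 2 *\<^sub>R u"] by (simp add: f_def)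
    then show "(1 - y) * (1 - y) = 1 - x" by (simp add: algebra_simps scaleR_2)
  qed
qed

text \<open>Apply the \<open>C\<^sup>*\<close>-identity to \<open>q + \<i> w\<close>.\<close>

lemma norm_square_le_sum:
  fixes q w :: "'b::unital_cstar_algebra"
  assumes "selfadjoint q" "selfadjoint w" "q * w = w * q"
  shows "norm (q * q) \<le> norm (q * q + w * w)"
proof -
  define u where "u = q + \<i> *\<^sub>C w"
  have scaleC_diff: "c *\<^sub>C (x - y) = c *\<^sub>C x - c *\<^sub>C y" for c and x y :: 'b
    using scaleC_add_right[of c "x - y" y] by (simp add: algebra_simps)
  have neg: "(- \<i>) *\<^sub>C w = - (\<i> *\<^sub>C w)"
    using scaleC_scaleC[of "-1" "\<i>" w] scaleC_of_real[of "-1" "\<i> *\<^sub>C w"] by simp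
  have ii: "\<i> *\<^sub>C \<i> *\<^sub>C z = - z" for z :: 'b
    using scaleC_of_real[of "-1" z] by (simp add: scaleC_scaleC)
  have au: "adj u = q - \<i> *\<^sub>C w"
    using assms neg by (simp add: u_def adj_add adj_scaleC selfadjoint_def)
  have "adj u * u = (q - \<i> *\<^sub>C w) * (q + \<i> *\<^sub>C w)" by (subst au) (simp only: u_def)
  also have "\<dots> = q * q + w * w"
    by (simp add: ring_distribs scaleC_mult_left scaleC_mult_right scaleC_add_right scaleC_diff ii assms(3))
  finally have eq: "norm (q * q + w * w) = (norm u)\<^sup>2" using cstar_identity[of u] by simp
  \<comment> \<open>Since \<open>q\<close> is the mean of \<open>u\<close> and \<open>adj u\<close>,
    its norm is at most \<open>norm u\<close>.\<close>
  have "u + adj u = q + q" unfolding au by (simp add: u_def)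
  then have "2 *\<^sub>R q = u + adj u" by (simp add: scaleR_2)
  then have "norm (2 *\<^sub>R q) \<le> norm u + norm (adj u)" by (simp only: norm_triangle_ineq)
  then have "norm q \<le> norm u" by (simp add: norm_adj)
  then show ?thesis
    using eq by (simp add: norm_square_selfadjoint[OF assms(1)] power_mono)
qed

section \<open>The cone of positive elements\<close>

text \<open>An order-theoretic substitute for \<open>spectrum \<subseteq> [0, \<infinity>)\<close>.\<close>

definition cpos :: "'b::unital_cstar_algebra \<Rightarrow> bool" where
  "cpos x \<longleftrightarrow> selfadjoint x \<and> (\<exists>t\<ge>0. norm (t *\<^sub>R 1 - x) \<le> t)"

lemma cpos_selfadjoint [simp]: "cpos x \<Longrightarrow> selfadjoint x"
  by (simp add: cpos_def)

lemma cpos_add: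
  assumes "cpos x" "cpos y"
  shows "cpos (x + y)"
proof -
  obtain s t where st: "s \<ge> 0" "norm (s *\<^sub>R 1 - x) \<le> s" "t \<ge> 0" "norm (t *\<^sub>R 1 - y) \<le> t"
    using assms by (auto simp: cpos_def)
  have "norm ((s + t) *\<^sub>R 1 - (x + y)) \<le> s + t"
    using norm_triangle_ineq[of "s *\<^sub>R 1 - x" "t *\<^sub>R 1 - y"] st by (simp add: algebra_simps)
  moreover have "0 \<le> s + t" using st by simp
  ultimately show ?thesis using assms unfolding cpos_def by auto
qed

lemma cpos_scaleR:
  assumes "cpos x" "r \<ge> 0"
  shows "cpos (r *\<^sub>R x)"
proof -
  obtain t where t: "t \<ge> 0" "norm (t *\<^sub>R 1 - x) \<le> t"
    using assms by (auto simp: cpos_def)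
  have "(r * t) *\<^sub>R 1 - r *\<^sub>R x = r *\<^sub>R (t *\<^sub>R 1 - x)" by (simp add: algebra_simps)
  then have "norm ((r * t) *\<^sub>R 1 - r *\<^sub>R x) \<le> r * t"
    using t assms by (simp add: mult_left_mono)
  moreover have "0 \<le> r * t" using t assms by simp
  ultimately show ?thesis using assms unfolding cpos_def by auto
qed

lemma cpos_norm_minus:
  assumes "selfadjoint x" "norm x \<le> t"
  shows "cpos (t *\<^sub>R 1 - x)"
proof -
  have "norm (t *\<^sub>R 1 - (t *\<^sub>R 1 - x)) \<le> t" using assms by simp
  moreover have "0 \<le> t" using assms norm_ge_zero order_trans by blast
  ultimately show ?thesis using assms unfolding cpos_def by auto
qed

text \<open>Scaled by \<open>1 / r\<close>, the square becomes \<open>x = p * p\<close> of norm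
  below 1, and \<open>1 - x\<close> has a root \<open>1 - y\<close> commuting with \<open>p\<close>.
  The two squares add up to 1, so \<open>norm_square_le_sum\<close> bounds
  \<open>norm (1 - x)\<close> by 1.\<close>

lemma norm_minus_square_le:
  assumes sa: "selfadjoint q" and lt: "(norm q)\<^sup>2 < r"
  shows "norm (r *\<^sub>R 1 - q * q) \<le> r"
proof -
  have r: "r > 0" using lt by (meson le_less_trans zero_le_power2)
  define x where "x = (1 / r) *\<^sub>R (q * q)"
  have "norm x < 1" using r lt by (simp add: x_def norm_square_selfadjoint[OF sa])
  moreover have "selfadjoint x" using sa by (simp add: x_def)
  ultimately obtain y where y: "selfadjoint y" "(1 - y) * (1 - y) = 1 - x" "y \<in> bicommutant x"
    using sqrt_one_minus[of x] by blast
  have rx: "r *\<^sub>R x = q * q" using r by (simp add: x_def)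
  have "q * y = y * q"
    by (rule bicommutantD[OF y(3)]) (simp add: x_def mult.assoc)
  define p where "p = (1 / sqrt r) *\<^sub>R q"
  have pp: "p * p = x" using r by (simp add: p_def x_def)
  have "norm ((1 - y) * (1 - y)) \<le> norm ((1 - y) * (1 - y) + p * p)"
    using \<open>q * y = y * q\<close> sa y(1)
    by (intro norm_square_le_sum) (simp_all add: p_def algebra_simps)
  then have "norm (1 - x) \<le> 1" by (simp add: y(2) pp)
  then have "norm (r *\<^sub>R (1 - x)) \<le> r" using r by simp
  then show ?thesis by (simp add: scaleR_diff_right rx)
qed

lemma cpos_square:
  assumes "selfadjoint q"
  shows "cpos (q * q)"
proof -
  have "norm (((norm q)\<^sup>2 + 1) *\<^sub>R 1 - q * q) \<le> (norm q)\<^sup>2 + 1"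
    by (rule norm_minus_square_le[OF assms]) simp
  moreover have "0 \<le> (norm q)\<^sup>2 + 1" by simp
  ultimately show ?thesis using assms unfolding cpos_def by (intro conjI exI) simp_all
qed

text \<open>Write \<open>p + \<epsilon> *\<^sub>R 1\<close> as
  \<open>(t + \<epsilon>) *\<^sub>R (1 - x)\<close>; then
  \<open>norm x \<le> t / (t + \<epsilon>) < 1\<close>, where \<epsilon> makes the inequality strict
  as \<open>sqrt_one_minus\<close> requires.\<close>

lemma cpos_sqrt:
  assumes p: "cpos p" and e: "\<epsilon> > 0"
  obtains q where "selfadjoint q" "q * q = p + \<epsilon> *\<^sub>R 1" "q \<in> bicommutant p"
proof -
  obtain t where t: "t \<ge> 0" "norm (t *\<^sub>R 1 - p) \<le> t" using p by (auto simp: cpos_def)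
  define x where "x = (1 / (t + \<epsilon>)) *\<^sub>R (t *\<^sub>R 1 - p)"
  have te: "t + \<epsilon> > 0" using t e by simp
  have "norm x < 1" using t e te by (simp add: x_def)
  moreover have "selfadjoint x" using p by (simp add: x_def)
  ultimately obtain y where y: "selfadjoint y" "(1 - y) * (1 - y) = 1 - x" "y \<in> bicommutant x"
    using sqrt_one_minus[of x] by blast
  show ?thesis
  proof
    define q where "q = sqrt (t + \<epsilon>) *\<^sub>R (1 - y)"
    show "selfadjoint q" using y by (simp add: q_def)
    have "q * q = (t + \<epsilon>) *\<^sub>R (1 - x)" using te y(2) by (simp add: q_def)
    also have "\<dots> = (t + \<epsilon>) *\<^sub>R 1 - (t *\<^sub>R 1 - p)"
      using te by (simp add: scaleR_diff_right x_def)
    also have "\<dots> = p + \<epsilon> *\<^sub>R 1" by (simp add: algebra_simps)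
    finally show "q * q = p + \<epsilon> *\<^sub>R 1" .
    have "z * q = q * z" if "z * p = p * z" for z
    proof -
      have "z * x = x * z" using that by (simp add: x_def algebra_simps)
      then have "z * y = y * z" by (rule bicommutantD[OF y(3)])
      then show ?thesis by (simp add: q_def algebra_simps)
    qed
    then show "q \<in> bicommutant p" by (simp add: bicommutant_def)
  qed
qed

text \<open>Replaces the unknown \<open>t\<close> of \<open>cpos\<close> by any bound of the norm:
  up to \<epsilon>, \<open>p\<close> is a square, and \<open>norm_minus_square_le\<close> applies to
  squares.\<close>

lemma norm_minus_cpos_le:
  assumes p: "cpos p" and le: "norm p \<le> t"
  shows "norm (t *\<^sub>R 1 - p) \<le> t"
proof (rule field_le_epsilon)
  fix \<delta> :: real assume "\<delta> > 0"
  define \<epsilon> where "\<epsilon> = \<delta> / 3"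
  have e: "\<epsilon> > 0" using \<open>\<delta> > 0\<close> by (simp add: \<epsilon>_def)
  obtain q where q: "selfadjoint q" "q * q = p + \<epsilon> *\<^sub>R 1" using cpos_sqrt[OF p e] by blast
  have "(norm q)\<^sup>2 \<le> t + \<epsilon>"
    using norm_triangle_ineq[of p "\<epsilon> *\<^sub>R 1"] le e q norm_square_selfadjoint[of q] by simp
  \<comment> \<open>The second \<epsilon> gives the strict inequality that
    \<open>norm_minus_square_le\<close> asks for.\<close>
  then have "norm ((t + (\<epsilon> + \<epsilon>)) *\<^sub>R 1 - q * q) \<le> t + (\<epsilon> + \<epsilon>)"
    using e by (intro norm_minus_square_le q) simp
  moreover have "t *\<^sub>R 1 - p = ((t + (\<epsilon> + \<epsilon>)) *\<^sub>R 1 - q * q) - \<epsilon> *\<^sub>R 1"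
    unfolding q(2) by (simp only: scaleR_left_distrib) simp
  ultimately have "norm (t *\<^sub>R 1 - p) \<le> t + 2 * \<epsilon> + \<epsilon>"
    using norm_triangle_ineq4[of "(t + (\<epsilon> + \<epsilon>)) *\<^sub>R 1 - q * q" "\<epsilon> *\<^sub>R 1"] e by simp
  then show "norm (t *\<^sub>R 1 - p) \<le> t + \<delta>" by (simp add: \<epsilon>_def)
qed

text \<open>The witness \<open>t\<close> may vary with the approximant, so it is first fixed through
  \<open>norm_minus_cpos_le\<close>; the inequality with \<open>t = norm p\<close> then survives the
  limit.\<close>

lemma cpos_limit:
  assumes sa: "selfadjoint p" and ex: "\<And>\<epsilon>. \<epsilon> > 0 \<Longrightarrow> \<exists>p'. cpos p' \<and> norm (p - p') \<le> \<epsilon>"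
  shows "cpos p"
proof -
  have "norm (norm p *\<^sub>R 1 - p) \<le> norm p"
  proof (rule field_le_epsilon)
    fix \<delta> :: real assume "\<delta> > 0"
    define \<epsilon> where "\<epsilon> = \<delta> / 3"
    have e: "\<epsilon> > 0" using \<open>\<delta> > 0\<close> by (simp add: \<epsilon>_def)
    obtain p' where p': "cpos p'" "norm (p - p') \<le> \<epsilon>" using ex[OF e] by blast
    have "norm p' \<le> norm p + \<epsilon>"
      using norm_triangle_ineq4[of p "p - p'"] p' by simp
    then have "norm ((norm p + \<epsilon>) *\<^sub>R 1 - p') \<le> norm p + \<epsilon>" by (rule norm_minus_cpos_le[OF p'(1)])
    moreover have "norm p *\<^sub>R 1 - p = ((norm p + \<epsilon>) *\<^sub>R 1 - p') - \<epsilon> *\<^sub>R 1 - (p - p')"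
      by (simp add: algebra_simps)
    ultimately have "norm (norm p *\<^sub>R 1 - p) \<le> norm p + \<epsilon> + \<epsilon> + \<epsilon>"
      using norm_triangle_ineq4[of "(norm p + \<epsilon>) *\<^sub>R 1 - p'" "\<epsilon> *\<^sub>R 1"]
        norm_triangle_ineq4[of "((norm p + \<epsilon>) *\<^sub>R 1 - p') - \<epsilon> *\<^sub>R 1" "p - p'"] p' e by simp
    then show "norm (norm p *\<^sub>R 1 - p) \<le> norm p + \<delta>" by (simp add: \<epsilon>_def)
  qed
  then show ?thesis using sa unfolding cpos_def by (metis norm_ge_zero)
qed

text \<open>A product of commuting squares is a square. Roots \<open>q\<close> and \<open>w\<close>
  exist only after adding \<delta>, so \<open>p * v\<close> is reached as a limit of the squares of
  \<open>q * w\<close>.\<close>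

lemma cpos_mult:
  assumes p: "cpos p" and v: "cpos v" and comm: "p * v = v * p"
  shows "cpos (p * v)"
proof (rule cpos_limit)
  show "selfadjoint (p * v)" using assms by (intro selfadjoint_mult) auto
  fix \<epsilon> :: real assume e: "\<epsilon> > 0"
  define K where "K = norm p + norm v + 1"
  define \<delta> where "\<delta> = min 1 (\<epsilon> / K)"
  have K: "K > 0" by (simp add: K_def add_nonneg_pos)
  have d: "\<delta> > 0" "\<delta> \<le> 1" "\<delta> * K \<le> \<epsilon>"
    using e K by (auto simp: \<delta>_def min_def field_simps)
  obtain q where q: "selfadjoint q" "q * q = p + \<delta> *\<^sub>R 1" "q \<in> bicommutant p"
    using cpos_sqrt[OF p d(1)] by blast
  obtain w where w: "selfadjoint w" "w * w = v + \<delta> *\<^sub>R 1" "w \<in> bicommutant v"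
    using cpos_sqrt[OF v d(1)] by blast
  \<comment> \<open>The bicommutant is used twice: \<open>v\<close> commutes with \<open>p\<close>,
    hence with \<open>q\<close>; then \<open>q\<close> commutes with \<open>v\<close>, hence with
    \<open>w\<close>.\<close>
  have "v * q = q * v" using bicommutantD[OF q(3)] comm by simp
  then have qw: "q * w = w * q" using bicommutantD[OF w(3)] by simp
  have "(q * w) * (q * w) = q * (w * q) * w" by (simp add: mult.assoc)
  also have "\<dots> = (q * q) * (w * w)" unfolding qw[symmetric] by (simp add: mult.assoc)
  also have "\<dots> = p * v + \<delta> *\<^sub>R p + \<delta> *\<^sub>R v + (\<delta> * \<delta>) *\<^sub>R 1"
    by (simp add: q w algebra_simps)
  finally have eq: "p * v - (q * w) * (q * w) = - (\<delta> *\<^sub>R (p + v + \<delta> *\<^sub>R 1))"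
    by (simp add: algebra_simps)
  have "norm (p + v + \<delta> *\<^sub>R 1) \<le> K"
    using norm_triangle_ineq[of "p + v" "\<delta> *\<^sub>R 1"] norm_triangle_ineq[of p v] d by (simp add: K_def)
  then have "norm (p * v - (q * w) * (q * w)) \<le> \<delta> * K"
    unfolding eq using d by (simp add: mult_left_mono)
  moreover have "cpos ((q * w) * (q * w))" using qw q w by (intro cpos_square selfadjoint_mult)
  ultimately show "\<exists>p'. cpos p' \<and> norm (p * v - p') \<le> \<epsilon>" using d by (meson order_trans)
qed

text \<open>Up to \<epsilon>, both \<open>u\<close> and \<open>r *\<^sub>R 1 - u\<close> are squares
  of commuting self-adjoint elements whose sum is a scalar near \<open>r\<close>;
  \<open>norm_square_le_sum\<close> compares the first square with this sum.\<close>

lemma norm_le_of_cpos: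
  assumes u: "cpos u" and v: "cpos (r *\<^sub>R 1 - u)" and r: "r \<ge> 0"
  shows "norm u \<le> r"
proof (rule field_le_epsilon)
  fix \<delta> :: real assume "\<delta> > 0"
  define \<epsilon> where "\<epsilon> = \<delta> / 3"
  have e: "\<epsilon> > 0" using \<open>\<delta> > 0\<close> by (simp add: \<epsilon>_def)
  obtain q where q: "selfadjoint q" "q * q = u + \<epsilon> *\<^sub>R 1" "q \<in> bicommutant u"
    using cpos_sqrt[OF u e] by blast
  obtain w where w: "selfadjoint w" "w * w = (r *\<^sub>R 1 - u) + \<epsilon> *\<^sub>R 1" "w \<in> bicommutant (r *\<^sub>R 1 - u)"
    using cpos_sqrt[OF v e] by blast
  have "u * q = q * u" using bicommutantD[OF q(3)] by simp
  then have "q * w = w * q" by (intro bicommutantD[OF w(3)]) (simp add: algebra_simps)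
  then have "norm (q * q) \<le> norm (q * q + w * w)" using q w by (intro norm_square_le_sum)
  also have "q * q + w * w = (r + (\<epsilon> + \<epsilon>)) *\<^sub>R 1"
    unfolding q w by (simp only: scaleR_left_distrib) simp
  finally have "norm (u + \<epsilon> *\<^sub>R 1) \<le> \<bar>r + (\<epsilon> + \<epsilon>)\<bar>"
    by (simp only: q norm_scaleR norm_one mult_1_right)
  then have "norm u \<le> r + 2 * \<epsilon> + \<epsilon>"
    using norm_triangle_ineq4[of "u + \<epsilon> *\<^sub>R 1" "\<epsilon> *\<^sub>R 1"] e r by simp
  then show "norm u \<le> r + \<delta>" by (simp add: \<epsilon>_def)
qed

section \<open>Positive elements and invertibility\<close>

lemma is_inverse_nonzero:
  fixes a b :: "'b::unital_cstar_algebra"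
  shows "is_inverse a b \<Longrightarrow> a \<noteq> 0 \<and> b \<noteq> 0"
  by (auto simp: is_inverse_def)

text \<open>Multiplying the positive element \<open>norm y *\<^sub>R 1 - y\<close> by the commuting
  positive \<open>p\<close> gives \<open>norm y *\<^sub>R p - 1\<close>. In spectral terms, the
  spectrum of \<open>p\<close> lies above \<open>1 / norm y\<close>.\<close>

lemma cpos_minus_inverse_norm:
  fixes p :: "'b::unital_cstar_algebra"
  assumes p: "cpos p" and y: "is_inverse p y"
  shows "cpos (p - (1 / norm y) *\<^sub>R 1)"
proof -
  have ny: "norm y > 0" using is_inverse_nonzero[OF y] by simp
  have py: "p * y = 1" "y * p = 1" using y by (auto simp: is_inverse_def)
  have sy: "selfadjoint y" using selfadjoint_inverse[OF y] p by simp
  have "cpos (p * (norm y *\<^sub>R 1 - y))"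
    by (intro cpos_mult p cpos_norm_minus sy) (simp_all add: algebra_simps py)
  then have "cpos ((1 / norm y) *\<^sub>R (p * (norm y *\<^sub>R 1 - y)))" by (rule cpos_scaleR) simp
  moreover have "(1 / norm y) *\<^sub>R (p * (norm y *\<^sub>R 1 - y)) = p - (1 / norm y) *\<^sub>R 1"
    using ny by (simp add: algebra_simps py)
  ultimately show ?thesis by simp
qed

lemma norm_minus_invertible_cpos:
  fixes p :: "'b::unital_cstar_algebra"
  assumes p: "cpos p" and y: "is_inverse p y"
  shows "norm (norm p *\<^sub>R 1 - p) \<le> norm p - 1 / norm y"
proof (rule norm_le_of_cpos)
  have ny: "norm y > 0" using is_inverse_nonzero[OF y] by simp
  show "cpos (norm p *\<^sub>R 1 - p)" using p by (intro cpos_norm_minus) auto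
  show "cpos ((norm p - 1 / norm y) *\<^sub>R 1 - (norm p *\<^sub>R 1 - p))"
    using cpos_minus_inverse_norm[OF p y] by (simp add: scaleR_diff_left)
  have "1 \<le> norm p * norm y" using norm_mult_ineq[of p y] y by (simp only: is_inverse_def norm_one)
  then show "0 \<le> norm p - 1 / norm y" using ny by (simp add: pos_divide_le_eq)
qed

text \<open>The norm of a positive element lies in its spectrum. Indeed an inverse \<open>z\<close>
  would give \<open>1 - p\<close> the lower bound \<open>1 / norm z\<close>, forcing
  \<open>norm p \<le> 1 - 1 / norm z < 1\<close>.\<close>

lemma one_minus_cpos_not_invertible:
  fixes p :: "'b::unital_cstar_algebra"
  assumes p: "cpos p" and n: "norm p = 1"
  shows "\<not> is_inverse (1 - p) z"
proof
  assume z: "is_inverse (1 - p) z"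
  have c: "cpos (1 - p)" using cpos_norm_minus[of p 1] p n by simp
  have nz: "norm z > 0" using is_inverse_nonzero[OF z] by simp
  have "norm p \<le> 1 - 1 / norm z"
  proof (rule norm_le_of_cpos[OF p])
    show "cpos ((1 - 1 / norm z) *\<^sub>R 1 - p)"
    proof -
      have "(1 - 1 / norm z) *\<^sub>R 1 - p = 1 - p - (1 / norm z) *\<^sub>R 1" by (simp add: algebra_simps)
      then show ?thesis using cpos_minus_inverse_norm[OF c z] by (simp only:)
    qed
    have "norm (1 - p) \<le> 1" using norm_minus_cpos_le[OF p, of 1] n by simp
    then have "norm (1 - p) * norm z \<le> 1 * norm z" by (intro mult_right_mono) simp_all
    moreover have "1 \<le> norm (1 - p) * norm z"
      using norm_mult_ineq[of "1 - p" z] z by (simp only: is_inverse_def norm_one)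
    ultimately have "1 \<le> norm z" by linarith
    then show "0 \<le> 1 - 1 / norm z" using nz by simp
  qed
  then show False using n nz by simp
qed

section \<open>Inverses in the subalgebra\<close>

context banach_star_subalgebra
begin

lemma scaleR_mem: "x \<in> A \<Longrightarrow> r *\<^sub>R x \<in> A"
  using scaleC_mem[of x "complex_of_real r"] by (simp add: scaleC_of_real)

lemma normA_scaleR: "x \<in> A \<Longrightarrow> normA (r *\<^sub>R x) = \<bar>r\<bar> * normA x"
  using normA_scaleC[of x "complex_of_real r"] by (simp add: scaleC_of_real)

lemma minus_mem: "x \<in> A \<Longrightarrow> - x \<in> A"
  using scaleR_mem[of x "-1"] by simp

lemma diff_mem: "x \<in> A \<Longrightarrow> y \<in> A \<Longrightarrow> x - y \<in> A"
  using add_mem[of x "- y"] minus_mem by simp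

lemma power_mem: "x \<in> A \<Longrightarrow> x ^ n \<in> A"
  by (induction n) (auto simp: one_mem mult_mem)

lemma normA_minus: "x \<in> A \<Longrightarrow> normA (- x) = normA x"
  using normA_scaleR[of x "-1"] by simp

lemma normA_diff_le: "x \<in> A \<Longrightarrow> y \<in> A \<Longrightarrow> normA (x - y) \<le> normA x + normA y"
  using normA_triangle[of x "- y"] minus_mem normA_minus by simp

lemma normA_power: "x \<in> A \<Longrightarrow> normA (x ^ n) \<le> normA x ^ n"
proof (induction n)
  case (Suc n)
  have "normA (x ^ Suc n) \<le> normA x * normA (x ^ n)"
    using normA_mult[of x "x ^ n"] power_mem Suc.prems by simp
  also have "\<dots> \<le> normA x * normA x ^ n"
    using Suc normA_nonneg by (intro mult_left_mono) auto
  finally show ?case by simp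
qed (simp add: normA_one)

text \<open>The inverse is the infinite product of the factors \<open>1 + s\<^bsup>2^k\<^esup>\<close>.\<close>

lemma inverse_one_minus_product:
  assumes s: "s \<in> A" and sum: "summable f" and le: "\<And>k. normA (s ^ (2 ^ k)) \<le> f k"
  shows "convergent_prod (\<lambda>k. 1 + f k)"
    and "\<exists>l\<in>A. is_inverse (1 - s) l \<and> normA l \<le> (\<Prod>k. 1 + f k)"
proof -
  have f0: "f k \<ge> 0" for k using le[of k] normA_nonneg[OF power_mem[OF s]] order_trans by blast
  show conv: "convergent_prod (\<lambda>k. 1 + f k)"
  proof (rule summable_imp_convergent_prod_real)
    show "summable (\<lambda>k. \<bar>f k\<bar>)" using sum f0 by simp
    show "f k \<noteq> - 1" for k using f0[of k] by linarith
  qed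
  define P where "P = (\<Prod>k. 1 + f k)"
  have prod_le: "(\<Prod>k<n. 1 + f k) \<le> P" for n
    unfolding P_def using f0
    by (intro prod_le_prodinf[OF convergent_prod_has_prod[OF conv]]) (auto intro: add_nonneg_nonneg)
  have P1: "P \<ge> 1" using prod_le[of 0] by simp
  define Q where "Q = rec_nat 1 (\<lambda>n q. q * (1 + s ^ (2 ^ n)))"
  have Q0: "Q 0 = 1" and QS: "Q (Suc n) = Q n * (1 + s ^ (2 ^ n))" for n
    by (simp_all add: Q_def)
  have sA: "s ^ n \<in> A" for n by (rule power_mem[OF s])
  have QA: "Q n \<in> A" for n
    by (induction n) (auto simp: Q0 QS one_mem intro!: mult_mem add_mem sA)
  have double: "(1 - s ^ (2 ^ n)) * (1 + s ^ (2 ^ n)) = 1 - s ^ (2 ^ Suc n)" for n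
    by (simp add: algebra_simps mult_2 flip: power_add)
  \<comment> \<open>The partial products telescope, since each new factor turns
    \<open>1 - s ^ (2 ^ n)\<close> into \<open>1 - s ^ (2 ^ Suc n)\<close>.\<close>
  have left: "(1 - s) * Q n = 1 - s ^ (2 ^ n)" for n
  proof (induction n)
    case (Suc n)
    have "(1 - s) * Q (Suc n) = ((1 - s) * Q n) * (1 + s ^ (2 ^ n))"
      by (simp only: QS mult.assoc)
    then show ?case by (simp only: Suc double)
  qed (simp add: Q0)
  have right: "Q n * (1 - s) = 1 - s ^ (2 ^ n)" for n
  proof (induction n)
    case (Suc n)
    have "(1 + s ^ (2 ^ n)) * (1 - s) = (1 - s) * (1 + s ^ (2 ^ n))"
      by (simp add: algebra_simps power_commutes)
    then have "Q (Suc n) * (1 - s) = (Q n * (1 - s)) * (1 + s ^ (2 ^ n))"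
      by (simp only: QS mult.assoc)
    then show ?case by (simp only: Suc double)
  qed (simp add: Q0)
  have Qle: "normA (Q n) \<le> P" for n
  proof -
    have "normA (Q n) \<le> (\<Prod>k<n. 1 + f k)"
    proof (induction n)
      case (Suc n)
      have "normA (1 + s ^ (2 ^ n)) \<le> 1 + f n"
        using normA_triangle[OF one_mem sA[of "2 ^ n"]] le[of n] normA_one by simp
      then have "normA (Q n) * normA (1 + s ^ (2 ^ n)) \<le> (\<Prod>k<n. 1 + f k) * (1 + f n)"
        using Suc f0 by (intro mult_mono normA_nonneg add_mem one_mem sA prod_nonneg)
          (auto intro: add_nonneg_nonneg)
      then show ?case
        using normA_mult[OF QA[of n] add_mem[OF one_mem sA[of "2 ^ n"]]] by (simp add: QS)
    qed (simp add: Q0 normA_one)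
    then show ?thesis using prod_le order_trans by blast
  qed
  define F where "F n = (\<Sum>k<n. f k)" for n
  \<comment> \<open>The increment \<open>Q (Suc n) - Q n = Q n * s ^ (2 ^ n)\<close> has norm at
    most \<open>P * f n\<close>, so \<open>Q\<close> inherits the Cauchy property from the partial
    sums \<open>F\<close>.\<close>
  have step: "normA (Q (n + d) - Q n) \<le> P * (F (n + d) - F n)" for n d
  proof (induction d)
    case 0
    show ?case using normA_eq_0_iff[OF diff_mem[OF one_mem one_mem]] by simp
  next
    case (Suc d)
    have "Q (n + Suc d) - Q n = (Q (n + d) - Q n) + Q (n + d) * s ^ (2 ^ (n + d))"
      by (simp add: QS algebra_simps)
    also have "normA \<dots> \<le> normA (Q (n + d) - Q n) + normA (Q (n + d)) * normA (s ^ (2 ^ (n + d)))"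
      by (rule order_trans[OF normA_triangle add_left_mono[OF normA_mult]])
        (auto intro!: diff_mem mult_mem QA sA)
    also have "\<dots> \<le> P * (F (n + d) - F n) + P * f (n + d)"
      using Suc Qle le P1 by (intro add_mono mult_mono normA_nonneg sA) auto
    also have "\<dots> = P * (F (n + Suc d) - F n)" by (simp add: F_def algebra_simps)
    finally show ?case .
  qed
  have dist_Q: "normA (Q m - Q n) \<le> P * \<bar>F m - F n\<bar>" for m n
  proof (cases "n \<le> m")
    case True
    then have "normA (Q m - Q n) \<le> P * (F m - F n)" using step[of n "m - n"] by simp
    also have "\<dots> \<le> P * \<bar>F m - F n\<bar>" using P1 by (intro mult_left_mono) auto
    finally show ?thesis .
  next
    case False
    then have "normA (Q n - Q m) \<le> P * (F n - F m)" using step[of m "n - m"] by simp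
    also have "\<dots> \<le> P * \<bar>F m - F n\<bar>" using P1 by (intro mult_left_mono) auto
    finally show ?thesis using normA_minus[OF diff_mem[OF QA[of n] QA[of m]]] by simp
  qed
  have "Cauchy F"
    unfolding F_def using sum summable_LIMSEQ convergent_Cauchy convergent_def by blast
  then have "\<forall>\<epsilon>>0. \<exists>N. \<forall>m\<ge>N. \<forall>n\<ge>N. normA (Q m - Q n) < \<epsilon>"
  proof (intro allI impI)
    fix \<epsilon> :: real assume C: "Cauchy F" and e: "\<epsilon> > 0"
    have "\<epsilon> / P > 0" using e P1 by simp
    then obtain N where N: "\<And>m n. m \<ge> N \<Longrightarrow> n \<ge> N \<Longrightarrow> dist (F m) (F n) < \<epsilon> / P"
      using C unfolding Cauchy_def by blast
    have "normA (Q m - Q n) < \<epsilon>" if "m \<ge> N" "n \<ge> N" for m n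
      using N[OF that] dist_Q[of m n] P1 by (simp add: dist_real_def field_simps)
    then show "\<exists>N. \<forall>m\<ge>N. \<forall>n\<ge>N. normA (Q m - Q n) < \<epsilon>" by blast
  qed
  then obtain l where l: "l \<in> A" "(\<lambda>n. normA (Q n - l)) \<longlonglongrightarrow> 0"
    using normA_complete[of Q] QA by blast
  have f_lim: "f \<longlonglongrightarrow> 0" using sum by (rule summable_LIMSEQ_zero)
  have dA: "1 - s \<in> A" "Q n - l \<in> A" for n using s l QA by (auto intro: diff_mem one_mem)
  \<comment> \<open>Both defects, \<open>1 - (1 - s) * l\<close> and \<open>1 - l * (1 - s)\<close>,
    are bounded by this null sequence, by \<open>left\<close> and \<open>right\<close>
    respectively.\<close>
  have zeroI: "x = 0" if x: "x \<in> A" and le: "\<And>n. normA x \<le> normA (1 - s) * normA (Q n - l) + f n" for x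
  proof -
    have "(\<lambda>n. normA (1 - s) * normA (Q n - l) + f n) \<longlonglongrightarrow> normA (1 - s) * 0 + 0"
      by (intro tendsto_intros l f_lim)
    then have "normA x \<le> normA (1 - s) * 0 + 0" by (rule LIMSEQ_le_const) (use le in blast)
    then show ?thesis using normA_nonneg[OF x] normA_eq_0_iff[OF x] by simp
  qed
  have "1 - (1 - s) * l = 0"
  proof (rule zeroI)
    fix n
    have "1 - (1 - s) * l = (1 - s) * (Q n - l) + s ^ (2 ^ n)"
      using left[of n] by (simp add: right_diff_distrib)
    also have "normA \<dots> \<le> normA (1 - s) * normA (Q n - l) + normA (s ^ (2 ^ n))"
      by (rule order_trans[OF normA_triangle add_right_mono[OF normA_mult]])
        (auto intro!: mult_mem dA sA)
    finally show "normA (1 - (1 - s) * l) \<le> normA (1 - s) * normA (Q n - l) + f n"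
      using le[of n] by linarith
  qed (intro diff_mem mult_mem one_mem s l)
  moreover have "1 - l * (1 - s) = 0"
  proof (rule zeroI)
    fix n
    have "1 - l * (1 - s) = (Q n - l) * (1 - s) + s ^ (2 ^ n)"
      using right[of n] by (simp add: left_diff_distrib)
    also have "normA \<dots> \<le> normA (Q n - l) * normA (1 - s) + normA (s ^ (2 ^ n))"
      by (rule order_trans[OF normA_triangle add_right_mono[OF normA_mult]])
        (auto intro!: mult_mem dA sA)
    finally show "normA (1 - l * (1 - s)) \<le> normA (1 - s) * normA (Q n - l) + f n"
      using le[of n] by (simp add: mult.commute)
  qed (intro diff_mem mult_mem one_mem s l)
  ultimately have "is_inverse (1 - s) l" by (simp add: is_inverse_def)
  moreover have "normA l \<le> P"
  proof -
    have "(\<lambda>n. P + normA (Q n - l)) \<longlonglongrightarrow> P + 0" by (intro tendsto_intros l)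
    moreover have "normA l \<le> P + normA (Q n - l)" for n
      using normA_diff_le[OF QA dA(2), of n n] Qle[of n] by simp
    ultimately have "normA l \<le> P + 0" by (intro LIMSEQ_le_const) auto
    then show ?thesis by simp
  qed
  ultimately show "\<exists>l\<in>A. is_inverse (1 - s) l \<and> normA l \<le> (\<Prod>k. 1 + f k)"
    using l(1) unfolding P_def by blast
qed

lemma inverse_one_minus:
  assumes s: "s \<in> A" and lt: "normA s < 1"
  obtains l where "l \<in> A" "is_inverse (1 - s) l"
proof -
  have "summable (\<lambda>k. normA s ^ (2 ^ k))"
  proof (rule summable_comparison_test)
    show "\<exists>N. \<forall>k\<ge>N. norm (normA s ^ (2 ^ k)) \<le> normA s ^ k"
      using lt normA_nonneg[OF s] by (auto intro!: power_decreasing less_imp_le[OF less_exp])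
    show "summable (\<lambda>k. normA s ^ k)" using lt normA_nonneg[OF s] by (intro summable_geometric) simp
  qed
  then show ?thesis
    using inverse_one_minus_product(2)[OF s _ normA_power[OF s]] that by blast
qed

end

section \<open>Positivity of \<open>a\<^sup>* a\<close>\<close>

text \<open>Makes \<open>inverse_one_minus\<close> available in the ambient algebra with its own
  norm.\<close>

lemma banach_star_subalgebra_UNIV:
  "banach_star_subalgebra (UNIV :: 'b::unital_cstar_algebra set) norm"
proof
  fix f :: "nat \<Rightarrow> 'b"
  assume "\<forall>\<epsilon>>0. \<exists>N. \<forall>m\<ge>N. \<forall>n\<ge>N. norm (f m - f n) < \<epsilon>"
  then have "Cauchy f" by (simp add: Cauchy_def dist_norm)
  then obtain l where "f \<longlonglongrightarrow> l" using Cauchy_convergent convergent_def by blast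
  then have "(\<lambda>n. norm (f n - l)) \<longlonglongrightarrow> 0"
    using Lim_null tendsto_norm_zero by blast
  then show "\<exists>l\<in>UNIV. (\<lambda>n. norm (f n - l)) \<longlonglongrightarrow> 0" by blast
qed (auto simp: norm_triangle_ineq norm_scaleC norm_mult_ineq norm_adj)

text \<open>\<open>1 + p\<close> is \<open>t + 1\<close> times \<open>1 - x\<close> with
  \<open>norm x \<le> t / (t + 1) < 1\<close>.\<close>

lemma one_plus_cpos_invertible:
  fixes p :: "'b::unital_cstar_algebra"
  assumes "cpos p"
  obtains v where "is_inverse (1 + p) v"
proof -
  obtain t where t: "t \<ge> 0" "norm (t *\<^sub>R 1 - p) \<le> t" using assms by (auto simp: cpos_def)
  define x where "x = (1 / (t + 1)) *\<^sub>R (t *\<^sub>R 1 - p)"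
  have "norm x < 1" using t by (simp add: x_def)
  then obtain l where l: "is_inverse (1 - x) l"
    using banach_star_subalgebra.inverse_one_minus[OF banach_star_subalgebra_UNIV, of x] by blast
  have "(t + 1) *\<^sub>R (1 - x) = (t + 1) *\<^sub>R 1 - (t *\<^sub>R 1 - p)"
    using t by (simp add: scaleR_diff_right x_def)
  also have "\<dots> = 1 + p" by (simp add: algebra_simps)
  finally have eq: "1 + p = (t + 1) *\<^sub>R (1 - x)" by (rule sym)
  have "is_inverse (1 + p) ((1 / (t + 1)) *\<^sub>R l)"
    unfolding eq using l t by (simp add: is_inverse_def)
  then show ?thesis by (rule that)
qed

text \<open>Jacobson's identity: \<open>c d\<close> and \<open>d c\<close> have the same nonzero spectrum.\<close>

lemma is_inverse_one_plus_swap: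
  fixes c d :: "'b::ring_1"
  assumes "is_inverse (1 + c * d) v"
  shows "is_inverse (1 + d * c) (1 - d * v * c)"
proof -
  have v: "v + c * d * v = 1" "v + v * c * d = 1"
    using assms by (simp_all add: is_inverse_def algebra_simps)
  have "(1 + d * c) * (1 - d * v * c) = 1 + d * c - d * (v + c * d * v) * c"
    by (simp add: algebra_simps)
  moreover have "(1 - d * v * c) * (1 + d * c) = 1 + d * c - d * (v + v * c * d) * c"
    by (simp add: algebra_simps)
  ultimately show ?thesis by (simp add: is_inverse_def v)
qed

text \<open>If \<open>c\<close> were nonzero, then \<open>u\<close>, the normalised
  \<open>- (adj c * c)\<close>, would be positive of norm 1, so \<open>1 - u\<close> would not be
  invertible. But positivity of \<open>c * adj c\<close> makes \<open>1 + c * d\<close> invertible,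
  and Jacobson's identity carries this over to \<open>1 + d * c = 1 - u\<close>.\<close>

lemma negative_adj_mult_zero:
  fixes c :: "'b::unital_cstar_algebra"
  assumes pos: "cpos (c * adj c)" and neg: "cpos (- (adj c * c))"
  shows "c = 0"
proof (rule ccontr)
  assume "c \<noteq> 0"
  define r where "r = (norm c)\<^sup>2"
  have r: "r > 0" using \<open>c \<noteq> 0\<close> by (simp add: r_def)
  define u where "u = (1 / r) *\<^sub>R (- (adj c * c))"
  have "cpos u" unfolding u_def using r by (intro cpos_scaleR neg) simp
  moreover have "norm u = 1" using r by (simp add: u_def cstar_identity flip: r_def)
  ultimately have not_inv: "\<not> is_inverse (1 - u) z" for z by (rule one_minus_cpos_not_invertible)
  define d where "d = (1 / r) *\<^sub>R adj c"
  have "cpos ((1 / r) *\<^sub>R (c * adj c))" using r by (intro cpos_scaleR pos) simp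
  then obtain v where "is_inverse (1 + (1 / r) *\<^sub>R (c * adj c)) v"
    by (rule one_plus_cpos_invertible)
  then have "is_inverse (1 + c * d) v" by (simp add: d_def)
  then have "is_inverse (1 + d * c) (1 - d * v * c)" by (rule is_inverse_one_plus_swap)
  moreover have "1 + d * c = 1 - u" by (simp add: d_def u_def)
  ultimately show False using not_inv by simp
qed

text \<open>With \<open>h = a\<^sup>* a\<close> and \<open>m = \<bar>h\<bar>\<close>, the element \<open>d = m - h\<close> is twice the negative part of \<open>h\<close>;
  \<open>c = a d\<close> satisfies \<open>c\<^sup>* c = - m d\<^sup>2\<close>, which forces \<open>c = 0\<close>.\<close>

lemma cpos_adj_mult:
  fixes a b :: "'b::unital_cstar_algebra"
  assumes ab: "is_inverse a b"
  shows "cpos (adj a * a)"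
proof -
  define h where "h = adj a * a"
  define y where "y = b * adj b"
  have sh: "selfadjoint h" by (simp add: h_def)
  have ab1: "a * b = 1" "b * a = 1" using ab by (auto simp: is_inverse_def)
  have adj1: "adj a * adj b = 1" "adj b * adj a = 1"
    using adj_mult[of b a] adj_mult[of a b] ab1 by simp_all
  have "h * y = adj a * (a * b) * adj b" "y * h = b * (adj b * adj a) * a"
    by (simp_all add: h_def y_def mult.assoc)
  then have hy: "h * y = 1" "y * h = 1" by (simp_all add: ab1 adj1)
  have "(h * h) * (y * y) = h * (h * y) * y" "(y * y) * (h * h) = y * (y * h) * h"
    by (simp_all only: mult.assoc)
  then have inv: "is_inverse (h * h) (y * y)" by (simp add: is_inverse_def hy)
  define g where "g = h * h"
  have g: "cpos g" unfolding g_def using sh by (rule cpos_square)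
  have ng: "norm g > 0" "norm (y * y) > 0" using is_inverse_nonzero[OF inv] by (simp_all add: g_def)
  \<comment> \<open>Invertibility of \<open>g\<close> makes \<open>norm x < 1\<close>, so
    \<open>m\<close> is an exact root of \<open>h * h\<close>, with no \<epsilon>.\<close>
  define x where "x = 1 - (1 / norm g) *\<^sub>R g"
  have "x = (1 / norm g) *\<^sub>R (norm g *\<^sub>R 1 - g)"
    using ng by (simp add: x_def scaleR_diff_right)
  moreover have "norm (norm g *\<^sub>R 1 - g) < norm g"
  proof -
    have "norm (norm g *\<^sub>R 1 - g) \<le> norm g - 1 / norm (y * y)"
      by (rule norm_minus_invertible_cpos[OF g inv[folded g_def]])
    moreover have "1 / norm (y * y) > 0" using ng by simp
    ultimately show ?thesis by linarith
  qed
  ultimately have "norm x < 1" using ng by simp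
  moreover have "selfadjoint x" using g by (simp add: x_def)
  ultimately obtain w where w: "selfadjoint w" "norm w < 1" "(1 - w) * (1 - w) = 1 - x"
      "w \<in> bicommutant x"
    using sqrt_one_minus by blast
  define m where "m = sqrt (norm g) *\<^sub>R (1 - w)"
  have mm: "m * m = h * h"
  proof -
    have "m * m = norm g *\<^sub>R (1 - x)" using ng w(3) by (simp add: m_def)
    then show ?thesis using ng by (simp add: x_def g_def)
  qed
  have "cpos (1 - w)" using cpos_norm_minus[OF w(1), of 1] w(2) by simp
  then have m: "cpos m" unfolding m_def by (rule cpos_scaleR) simp
  have "h * x = x * h" by (simp add: x_def g_def algebra_simps)
  then have "h * w = w * h" by (rule bicommutantD[OF w(4)])
  then have hm: "h * m = m * h" by (simp add: m_def algebra_simps)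
  define d where "d = m - h"
  define c where "c = a * d"
  have sd: "selfadjoint d" using m sh by (simp add: d_def)
  have hd: "h * d = - (m * d)" by (simp add: d_def algebra_simps mm hm)
  have md: "m * d = d * m" by (simp add: d_def algebra_simps hm)
  have "adj c * c = d * h * d"
    using sd by (simp add: c_def h_def adj_mult selfadjoint_def mult.assoc)
  also have "\<dots> = - (d * m * d)" by (simp add: hd mult.assoc)
  also have "\<dots> = - (m * (d * d))" by (simp add: mult.assoc flip: md)
  finally have cc: "- (adj c * c) = m * (d * d)" by simp
  have "m * (d * d) = d * d * m" by (metis md mult.assoc)
  then have neg: "cpos (- (adj c * c))" unfolding cc by (intro cpos_mult m cpos_square sd)
  \<comment> \<open>\<open>c + adj c\<close> and \<open>k\<close> are, up to sign, twice the real
    and imaginary parts of \<open>c\<close>. The sum of their squares is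
    \<open>2 *\<^sub>R (c * adj c + adj c * c)\<close>, so this is positive; adding
    \<open>neg\<close> leaves \<open>c * adj c\<close>.\<close>
  define k where "k = \<i> *\<^sub>C (c - adj c)"
  have kk: "k * k = - ((c - adj c) * (c - adj c))"
    using scaleC_of_real[of "-1" "(c - adj c) * (c - adj c)"]
    by (simp add: k_def scaleC_mult_left scaleC_mult_right scaleC_scaleC)
  have "adj k = - \<i> *\<^sub>C (adj c - c)" by (simp add: k_def adj_scaleC adj_diff adj_adj)
  also have "\<dots> = \<i> *\<^sub>C (- 1) *\<^sub>C (adj c - c)" by (simp add: scaleC_scaleC)
  also have "\<dots> = k" using scaleC_of_real[of "-1" "adj c - c"] by (simp add: k_def)
  finally have sk: "selfadjoint k" by (simp add: selfadjoint_def)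
  have sc: "selfadjoint (c + adj c)" by (simp add: selfadjoint_def adj_add adj_adj add.commute)
  have "(c + adj c) * (c + adj c) + k * k = 2 *\<^sub>R (c * adj c + adj c * c)"
    by (simp add: kk algebra_simps scaleR_2)
  then have "cpos (2 *\<^sub>R (c * adj c + adj c * c))"
    using cpos_add[OF cpos_square[OF sc] cpos_square[OF sk]] by simp
  then have "cpos ((1/2) *\<^sub>R (2 *\<^sub>R (c * adj c + adj c * c)))" by (rule cpos_scaleR) simp
  then have "cpos (c * adj c + adj c * c)" by simp
  from cpos_add[OF this neg] have "cpos (c * adj c)" by simp
  then have "c = 0" using neg by (rule negative_adj_mult_zero)
  then have "b * (a * d) = 0" by (simp add: c_def)
  then have "d = 0" by (simp add: ab1 flip: mult.assoc)
  then show ?thesis using m by (simp add: d_def h_def)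
qed

text \<open>Apply \<open>norm_minus_invertible_cpos\<close> to \<open>adj a * a\<close>, whose norm
  is \<open>(norm a)\<^sup>2\<close> and whose inverse \<open>b * adj b\<close> has norm
  \<open>(norm b)\<^sup>2\<close>, and divide by \<open>(norm a)\<^sup>2\<close>.\<close>

lemma norm_one_minus_adj_mult_le:
  fixes a b :: "'b::unital_cstar_algebra"
  assumes ab: "is_inverse a b"
  shows "norm (1 - (1 / (norm a)\<^sup>2) *\<^sub>R (adj a * a)) \<le> 1 - 1 / ((norm a)\<^sup>2 * (norm b)\<^sup>2)"
proof -
  have ab1: "a * b = 1" "b * a = 1" using ab by (auto simp: is_inverse_def)
  have adj1: "adj a * adj b = 1" "adj b * adj a = 1"
    using adj_mult[of b a] adj_mult[of a b] ab1 by simp_all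
  have "adj a * a * (b * adj b) = adj a * (a * b) * adj b" "b * adj b * (adj a * a) = b * (adj b * adj a) * a"
    by (simp_all only: mult.assoc)
  then have inv: "is_inverse (adj a * a) (b * adj b)" by (simp add: is_inverse_def ab1 adj1)
  have na: "norm a > 0" using is_inverse_nonzero[OF ab] by simp
  have nb: "norm (b * adj b) = (norm b)\<^sup>2"
    using cstar_identity[of "adj b"] by (simp add: adj_adj norm_adj)
  have "norm ((norm a)\<^sup>2 *\<^sub>R 1 - adj a * a) \<le> (norm a)\<^sup>2 - 1 / (norm b)\<^sup>2"
    using norm_minus_invertible_cpos[OF cpos_adj_mult[OF ab] inv] by (simp add: nb cstar_identity)
  then have "(1 / (norm a)\<^sup>2) * norm ((norm a)\<^sup>2 *\<^sub>R 1 - adj a * a)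
      \<le> (1 / (norm a)\<^sup>2) * ((norm a)\<^sup>2 - 1 / (norm b)\<^sup>2)"
    by (rule mult_left_mono) simp
  also have "\<dots> = 1 - 1 / ((norm a)\<^sup>2 * (norm b)\<^sup>2)" using na by (simp add: right_diff_distrib)
  also have "(1 / (norm a)\<^sup>2) * norm ((norm a)\<^sup>2 *\<^sub>R 1 - adj a * a)
      = norm ((1 / (norm a)\<^sup>2) *\<^sub>R ((norm a)\<^sup>2 *\<^sub>R 1 - adj a * a))" by simp
  also have "(1 / (norm a)\<^sup>2) *\<^sub>R ((norm a)\<^sup>2 *\<^sub>R 1 - adj a * a) = 1 - (1 / (norm a)\<^sup>2) *\<^sub>R (adj a * a)"
    using na by (simp add: scaleR_diff_right)
  finally show ?thesis .
qed

text \<open>If \<open>\<parallel>x\<parallel>\<^sub>A < \<parallel>x\<parallel> = 1\<close> for self-adjoint \<open>x\<close>, then \<open>1 - x\<^sup>2\<close> would be invertible in \<open>A\<close> but not in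
  the ambient algebra.\<close>

lemma (in banach_star_subalgebra) norm_le_normA:
  assumes a: "a \<in> A"
  shows "norm a \<le> normA a"
proof -
  have sa: "norm x \<le> normA x" if x: "x \<in> A" "selfadjoint x" for x
  proof (rule ccontr)
    assume less: "\<not> norm x \<le> normA x"
    then have nx: "norm x > 0" using normA_nonneg[OF x(1)] by linarith
    define u where "u = (1 / norm x) *\<^sub>R x"
    have uA: "u \<in> A" using x by (simp add: u_def scaleR_mem)
    have su: "selfadjoint u" using x by (simp add: u_def)
    have "normA u < 1" using less nx normA_scaleR[OF x(1), of "1 / norm x"] by (simp add: u_def)
    then have "normA u * normA u < 1 * 1"
      using normA_nonneg[OF uA] by (intro mult_strict_mono') auto
    then have "normA (u * u) < 1" using normA_mult[OF uA uA] by simp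
    then obtain l where l: "is_inverse (1 - u * u) l"
      using inverse_one_minus[OF mult_mem[OF uA uA]] by blast
    have "norm (u * u) = 1" using nx by (simp add: norm_square_selfadjoint[OF su]) (simp add: u_def)
    then show False using one_minus_cpos_not_invertible[OF cpos_square[OF su]] l by blast
  qed
  \<comment> \<open>The general case follows from the self-adjoint one through the
    \<open>cstar_identity\<close>.\<close>
  have "(norm a)\<^sup>2 \<le> normA (adj a * a)"
    using sa[of "adj a * a"] a by (simp add: mult_mem adj_mem cstar_identity)
  also have "\<dots> \<le> (normA a)\<^sup>2"
    using normA_mult[OF adj_mem[OF a] a] normA_adj[OF a] by (simp add: power2_eq_square)
  finally show ?thesis using normA_nonneg[OF a] by (rule power2_le_imp_le)
qed

section \<open>The norm bound\<close>

text \<open>The summands solve, with equality, the recursion that the norm hypothesis yields for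
  repeated squaring, starting from \<open>f 0 = D\<close>.\<close>

lemma inv_bound_factor_recursion:
  fixes C D q \<theta> :: real
  assumes "C > 0" "D > 0" "0 \<le> q" "0 < \<theta>" "\<theta> < 1"
  defines "f \<equiv> \<lambda>k::nat. D powr ((1 + \<theta>) ^ k) * C powr (((1 + \<theta>) ^ k - 1) / \<theta>)
    * powr0 q (2 ^ k - (1 + \<theta>) ^ k)"
  shows "C * f k powr (1 + \<theta>) * (q ^ (2 ^ k)) powr (1 - \<theta>) = f (Suc k)"
proof -
  define e where "e = 2 ^ k - (1 + \<theta>) ^ k"
  \<comment> \<open>For \<open>q = 0\<close> both sides vanish because this exponent is positive;
    the convention for a zero exponent enters only at index 0.\<close>
  have pos: "2 ^ Suc k - (1 + \<theta>) ^ Suc k > 0"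
    using power_strict_mono[of "1 + \<theta>" 2 "Suc k"] assms by simp
  have e_Suc: "2 ^ Suc k - (1 + \<theta>) ^ Suc k = e * (1 + \<theta>) + 2 ^ k * (1 - \<theta>)"
    by (simp add: e_def algebra_simps)
  have q: "powr0 q e powr (1 + \<theta>) * (q ^ (2 ^ k)) powr (1 - \<theta>)
      = powr0 q (2 ^ Suc k - (1 + \<theta>) ^ Suc k)"
  proof (cases "q = 0")
    case True
    then show ?thesis using pos by (simp add: powr0_def)
  next
    case False
    then have q0: "q > 0" using assms by simp
    have "powr0 q x = q powr x" for x using q0 by (simp add: powr0_def)
    moreover have "q ^ (2 ^ k) = q powr (2 ^ k)" using powr_realpow[OF q0, of "2 ^ k"] by simp
    ultimately show ?thesis unfolding e_Suc by (simp only: powr_powr) (simp only: powr_add)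
  qed
  have "C * (C powr (((1 + \<theta>) ^ k - 1) / \<theta>)) powr (1 + \<theta>)
      = C powr (1 + ((1 + \<theta>) ^ k - 1) / \<theta> * (1 + \<theta>))"
    using assms(1) by (simp add: powr_powr) (simp add: powr_add)
  also have "1 + ((1 + \<theta>) ^ k - 1) / \<theta> * (1 + \<theta>) = ((1 + \<theta>) ^ Suc k - 1) / \<theta>"
    using assms by (simp add: field_simps)
  finally have C: "C * (C powr (((1 + \<theta>) ^ k - 1) / \<theta>)) powr (1 + \<theta>)
      = C powr (((1 + \<theta>) ^ Suc k - 1) / \<theta>)" .
  have D: "(D powr ((1 + \<theta>) ^ k)) powr (1 + \<theta>) = D powr ((1 + \<theta>) ^ Suc k)"
    by (simp add: powr_powr mult.commute)
  have "powr0 q e \<ge> 0" by (simp add: powr0_def)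
  then have "f k powr (1 + \<theta>) = (D powr ((1 + \<theta>) ^ k)) powr (1 + \<theta>)
      * (C powr (((1 + \<theta>) ^ k - 1) / \<theta>)) powr (1 + \<theta>) * powr0 q e powr (1 + \<theta>)"
    by (simp add: f_def e_def powr_mult)
  then have "C * f k powr (1 + \<theta>) * (q ^ (2 ^ k)) powr (1 - \<theta>)
      = (D powr ((1 + \<theta>) ^ k)) powr (1 + \<theta>) * (C * (C powr (((1 + \<theta>) ^ k - 1) / \<theta>)) powr (1 + \<theta>))
        * (powr0 q e powr (1 + \<theta>) * (q ^ (2 ^ k)) powr (1 - \<theta>))"
    by (simp only: mult_ac)
  then show ?thesis by (simp only: C D q f_def)
qed

text \<open>The summands decay doubly exponentially since \<open>(1 + \<theta>) / 2 < 1\<close>.\<close>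

lemma inv_bound_factor_summable:
  fixes C D q \<theta> :: real
  assumes "C > 0" "D > 0" "0 \<le> q" "q < 1" "0 < \<theta>" "\<theta> < 1"
  shows "summable (\<lambda>k::nat. D powr ((1 + \<theta>) ^ k) * C powr (((1 + \<theta>) ^ k - 1) / \<theta>)
    * powr0 q (2 ^ k - (1 + \<theta>) ^ k))"
    (is "summable ?f")
proof (cases "q = 0")
  case True
  show ?thesis
  \<comment> \<open>For \<open>q = 0\<close> only the term at 0 can be nonzero.\<close>
  proof (rule summable_finite[of "{0}"])
    fix k :: nat assume "k \<notin> {0}"
    then have "2 ^ k - (1 + \<theta>) ^ k > 0"
      using power_strict_mono[of "1 + \<theta>" 2 k] assms by simp
    then show "?f k = 0" using True by (simp add: powr0_def)
  qed simp
next
  case False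
  then have q: "q > 0" using assms by simp
  define \<mu> where "\<mu> = - ln q"
  \<comment> \<open>\<open>M\<close> collects the coefficients of \<open>(1 + \<theta>) ^ k\<close>
    in the logarithm of the summand, \<open>- N\<close> is the constant term and
    \<open>- \<mu>\<close> the coefficient of \<open>2 ^ k\<close>.\<close>
  define M where "M = ln D + ln C / \<theta> + \<mu>"
  define N where "N = ln C / \<theta>"
  have \<mu>: "\<mu> > 0" using q assms by (simp add: \<mu>_def)
  have f_exp: "?f k = exp (- N) * exp (2 ^ k * (M * ((1 + \<theta>) / 2) ^ k - \<mu>))" for k
  proof -
    have "powr0 q (2 ^ k - (1 + \<theta>) ^ k) = q powr (2 ^ k - (1 + \<theta>) ^ k)"
      using q by (simp add: powr0_def)
    then have "?f k = exp ((1 + \<theta>) ^ k * ln D + ((1 + \<theta>) ^ k - 1) / \<theta> * ln C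
        + (2 ^ k - (1 + \<theta>) ^ k) * ln q)"
      using assms q by (simp add: powr_def exp_add)
    also have "(1 + \<theta>) ^ k * ln D + ((1 + \<theta>) ^ k - 1) / \<theta> * ln C + (2 ^ k - (1 + \<theta>) ^ k) * ln q
        = - N + 2 ^ k * (M * ((1 + \<theta>) / 2) ^ k - \<mu>)"
      using assms by (simp add: M_def N_def \<mu>_def power_divide field_simps)
    finally show ?thesis by (simp only: exp_add)
  qed
  have "(\<lambda>k. M * ((1 + \<theta>) / 2) ^ k) \<longlonglongrightarrow> M * 0"
    using assms by (intro tendsto_intros LIMSEQ_realpow_zero) auto
  then have "eventually (\<lambda>k. M * ((1 + \<theta>) / 2) ^ k < \<mu> / 2) sequentially"
    using \<mu> by (intro order_tendstoD(2)) auto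
  then have ev: "eventually (\<lambda>k. norm (?f k) \<le> exp (- N) * exp (- (\<mu> / 2)) ^ k) sequentially"
  proof eventually_elim
    case (elim k)
    have "2 ^ k * (M * ((1 + \<theta>) / 2) ^ k - \<mu>) \<le> 2 ^ k * (- (\<mu> / 2))"
      using elim by (intro mult_left_mono) auto
    \<comment> \<open>The crude bound \<open>k \<le> 2 ^ k\<close> already leaves a convergent
      geometric series.\<close>
    also have "\<dots> \<le> real k * (- (\<mu> / 2))"
      using \<mu> by (intro mult_right_mono_neg) (auto intro: less_imp_le of_nat_less_two_power)
    finally have "exp (2 ^ k * (M * ((1 + \<theta>) / 2) ^ k - \<mu>)) \<le> exp (- (\<mu> / 2)) ^ k"
      by (simp add: exp_of_nat_mult[symmetric])
    then show ?case unfolding f_exp by (simp add: mult_left_mono)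
  qed
  show ?thesis
  proof (rule summable_comparison_test_ev[OF ev])
    show "summable (\<lambda>k. exp (- N) * exp (- (\<mu> / 2)) ^ k)"
      using \<mu> by (intro summable_mult summable_geometric) simp
  qed
qed

text \<open>Convergence of the product is asserted alongside the bound, so that the infinite product
  denotes a genuine limit.\<close>

theorem proposition2p2:
  fixes A :: "'b::unital_cstar_algebra set"
    and normA :: "'b \<Rightarrow> real"
    and C \<theta> :: real
  assumes "banach_star_subalgebra A normA"
    and "C > 0" and "0 < \<theta>" and "\<theta> < 1"
    and "\<And>a. a \<in> A \<Longrightarrow>
           normA (a\<^sup>2) \<le> C * normA a powr (1 + \<theta>) * norm a powr (1 - \<theta>)"
  shows "inverse_closed A \<and>
         (\<forall>a\<in>A. \<forall>b. is_inverse a b \<longrightarrow>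
            convergent_prod (inv_bound_factor C \<theta> (normA a) (norm a) (norm b)) \<and>
            normA b \<le> normA a / (norm a)\<^sup>2
              * (\<Prod>k. inv_bound_factor C \<theta> (normA a) (norm a) (norm b) k))"
proof -
  interpret banach_star_subalgebra A normA by (rule assms(1))
  have main: "b \<in> A \<and> convergent_prod (inv_bound_factor C \<theta> (normA a) (norm a) (norm b)) \<and>
      normA b \<le> normA a / (norm a)\<^sup>2
        * (\<Prod>k. inv_bound_factor C \<theta> (normA a) (norm a) (norm b) k)"
    if a: "a \<in> A" and ab: "is_inverse a b" for a b
  proof -
    have na: "norm a > 0" and nb: "norm b > 0" using is_inverse_nonzero[OF ab] by simp_all
    have nA: "norm a \<le> normA a" by (rule norm_le_normA[OF a])
    define h where "h = (1 / (norm a)\<^sup>2) *\<^sub>R (adj a * a)"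
    define s where "s = 1 - h"
    define D where "D = 2 * ((normA a)\<^sup>2 / (norm a)\<^sup>2)"
    define q where "q = 1 - 1 / ((norm a)\<^sup>2 * (norm b)\<^sup>2)"
    define f where "f k = D powr ((1 + \<theta>) ^ k) * C powr (((1 + \<theta>) ^ k - 1) / \<theta>)
      * powr0 q (2 ^ k - (1 + \<theta>) ^ k)" for k :: nat
    have f_eq: "inv_bound_factor C \<theta> (normA a) (norm a) (norm b) = (\<lambda>k. 1 + f k)"
      by (simp add: f_def inv_bound_factor_def D_def q_def fun_eq_iff)
    have hA: "adj a * a \<in> A" using a by (simp add: mult_mem adj_mem)
    then have sA: "s \<in> A" unfolding s_def h_def by (intro diff_mem one_mem scaleR_mem)
    have ns: "norm s \<le> q"
      unfolding s_def h_def q_def by (rule norm_one_minus_adj_mult_le[OF ab])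
    then have q0: "0 \<le> q" using norm_ge_zero order_trans by blast
    have q1: "q < 1" using na nb by (simp add: q_def)
    have D1: "1 \<le> (normA a)\<^sup>2 / (norm a)\<^sup>2"
      using na nA by (simp add: power_mono)
    then have D0: "D > 0" by (simp add: D_def)
    \<comment> \<open>The 1 coming from the unit is absorbed by \<open>D1\<close>, that is by
      \<open>norm a \<le> normA a\<close>; this produces the factor 2 in \<open>D\<close>.\<close>
    have nsA: "normA s \<le> D"
    proof -
      have "normA h \<le> (normA a)\<^sup>2 / (norm a)\<^sup>2"
        using normA_mult[OF adj_mem[OF a] a] normA_adj[OF a] normA_scaleR[OF hA, of "1 / (norm a)\<^sup>2"]
        by (simp add: h_def power2_eq_square divide_right_mono)
      moreover have "normA s \<le> 1 + normA h"
        unfolding s_def using normA_diff_le[OF one_mem scaleR_mem[OF hA]] normA_one by (simp add: h_def)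
      ultimately show ?thesis using D1 by (simp add: D_def)
    qed
    \<comment> \<open>At 0 the exponent of \<open>q\<close> is 0 and \<open>f 0 = D\<close>. Each
      squaring combines the norm hypothesis with
      \<open>norm (s ^ (2 ^ k)) \<le> q ^ (2 ^ k)\<close>.\<close>
    have s_pow: "normA (s ^ (2 ^ k)) \<le> f k" for k
    proof (induction k)
      case 0
      then show ?case using nsA D0 assms(2) by (simp add: f_def powr0_def)
    next
      case (Suc k)
      have pA: "s ^ (2 ^ k) \<in> A" by (rule power_mem[OF sA])
      have "normA ((s ^ (2 ^ k))\<^sup>2)
          \<le> C * normA (s ^ (2 ^ k)) powr (1 + \<theta>) * norm (s ^ (2 ^ k)) powr (1 - \<theta>)"
        by (rule assms(5)[OF pA])
      also have "\<dots> \<le> C * f k powr (1 + \<theta>) * (q ^ (2 ^ k)) powr (1 - \<theta>)"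
      proof (intro mult_mono powr_mono2)
        show "norm (s ^ (2 ^ k)) \<le> q ^ (2 ^ k)"
          using norm_power_ineq[of s "2 ^ k"] power_mono[OF ns, of "2 ^ k"] by simp
      qed (use assms Suc normA_nonneg[OF pA] in auto)
      also have "\<dots> = f (Suc k)"
        unfolding f_def by (rule inv_bound_factor_recursion) (use assms D0 q0 in auto)
      finally show ?case by (simp add: power2_eq_square mult_2 flip: power_add)
    qed
    have "summable f"
      unfolding f_def by (rule inv_bound_factor_summable) (use assms D0 q0 q1 in auto)
    note product = inverse_one_minus_product[OF sA this s_pow]
    obtain l where l: "l \<in> A" "is_inverse (1 - s) l"
        "normA l \<le> (\<Prod>k. inv_bound_factor C \<theta> (normA a) (norm a) (norm b) k)"
      using product(2) unfolding f_eq by blast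
    \<comment> \<open>Since \<open>1 - s = h\<close> contains \<open>adj a * a\<close>, the equation
      \<open>l * h = 1\<close> exhibits a left inverse of \<open>a\<close>, which must be
      \<open>b\<close>.\<close>
    have lb: "(1 / (norm a)\<^sup>2) *\<^sub>R (l * adj a) = b"
    proof (rule is_inverse_left_unique[OF ab, symmetric])
      show "(1 / (norm a)\<^sup>2) *\<^sub>R (l * adj a) * a = 1"
        using l(2) by (simp add: is_inverse_def s_def h_def mult.assoc)
    qed
    have "b \<in> A" unfolding lb[symmetric] by (intro scaleR_mem mult_mem l adj_mem a)
    moreover have "normA b \<le> normA a / (norm a)\<^sup>2
        * (\<Prod>k. inv_bound_factor C \<theta> (normA a) (norm a) (norm b) k)"
    proof -
      have "normA b = (1 / (norm a)\<^sup>2) * normA (l * adj a)"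
        using normA_scaleR[OF mult_mem[OF l(1) adj_mem[OF a]], of "1 / (norm a)\<^sup>2"] by (simp add: lb)
      also have "\<dots> \<le> (1 / (norm a)\<^sup>2) * (normA l * normA a)"
        using normA_mult[OF l(1) adj_mem[OF a]] normA_adj[OF a] by (intro mult_left_mono) auto
      also have "\<dots> = normA a / (norm a)\<^sup>2 * normA l" by simp
      also have "\<dots> \<le> normA a / (norm a)\<^sup>2
          * (\<Prod>k. inv_bound_factor C \<theta> (normA a) (norm a) (norm b) k)"
        using normA_nonneg[OF a] by (intro mult_left_mono l) simp
      finally show ?thesis .
    qed
    ultimately show ?thesis using product(1) unfolding f_eq by blast
  qed
  then show ?thesis unfolding inverse_closed_def by blast
qed

end
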